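(* Let $L\subseteq R$. Consider axiom systems $\mathcal{A}$ satisfying $\mathcal{A}\sim\mathcal{A}_L\cup\{\tau^{\mathcal{A}}\}$. (a) If $D\cap L-\{\max L\}\neq\emptyset$, then every consistent such $\mathcal{A}$ is equivalent to $\mathcal{A}_L$, and $D^{\mathcal{A}}_{\mathrm{surpr}}=D\cap L-\{\max L\}$. (b) If $D\cap L\subseteq\{\max L\}$, then every such $\mathcal{A}$ is inconsistent, and $D^{\mathcal{A}}_{\mathrm{surpr}}=\emptyset$.
   Context: Let $R=\{\mathrm{Mo},\mathrm{Tu},\mathrm{We},\mathrm{Th},\mathrm{Fr},\mathrm{none}\}$ be linearly ordered by $\mathrm{Mo}<\mathrm{Tu}<\mathrm{We}<\mathrm{Th}<\mathrm{Fr}<\mathrm{none}$, and $D=\{\mathrm{Mo},\dots,\mathrm{Fr}\}$. Propositional formulas are built from atoms $Y_r$ ($r\in R$) with $\bot,\to$ (usual derived connectives, $\top:=\neg\bot$). The axiom $(\mathrm{Ax}_{=1})$ is $\bigvee_{r\in R}Y_r\wedge\bigwedge_{r<s}(\neg Y_r\vee\neg Y_s)$; its models are identified with the elements of $R$ ($r$ makes exactly $Y_r$ true). An axiom system $\mathcal{A}$ is a set of formulas always containing $(\mathrm{Ax}_{=1})$; $\mathcal{A}\vdash\varphi$ is propositional provability; $\mathcal{A}$ is inconsistent if it proves every formula, consistent otherwise. Two axiom systems are equivalent, $\mathcal{A}_1\sim\mathcal{A}_2$, if each proves every formula of the other. For $B\subseteq R$: $\langle T\in B\rangle:=\bigvee_{r\in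 B}Y_r$, $\langle T\le d\rangle:=\langle T\in\{r:r\le d\}\rangle$. $\mathcal{A}_L$ denotes the axiom system $\{(\mathrm{Ax}_{=1}),\langle T\in L\rangle\}$. $K\subseteq R$ is an $\mathcal{A}$-p-knowledge set if $\mathcal{A}\vdash\langle T\in K\rangle$; $K_{\mathcal{A}}$ is the intersection of all of them. $d\in D$ is $\mathcal{A}$-p-surprising if $d\in K_{\mathcal{A}}$ and $\mathcal{A}\nvdash\langle T\le d\rangle$; $D^{\mathcal{A}}_{\mathrm{surpr}}$ is the set of these. Iverson brackets: $[S]$ is $\top$ if the assertion $S$ is true, $\bot$ otherwise. Define $\tau^{\mathcal{A}}:=\bigvee_{d\in D}\bigwedge_{K\subseteq R}\bigl([\,\mathcal{A}\vdash\langle T\in K\rangle\,]\to[\,d\in K-\{\max K\}\,]\bigr)$, with the convention $\emptyset-\{\max\emptyset\}=\emptyset$. *)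

theory Defs
  imports Main
begin

datatype day = Mo | Tu | We | Th | Fr | none

instantiation day :: linorder
begin

fun day_rank :: "day \<Rightarrow> nat" where
  "day_rank Mo = 0"
| "day_rank Tu = 1"
| "day_rank We = 2"
| "day_rank Th = 3"
| "day_rank Fr = 4"
| "day_rank none = 5"

definition less_eq_day :: "day \<Rightarrow> day \<Rightarrow> bool" where
  "r \<le> s \<longleftrightarrow> day_rank r \<le> day_rank s"

definition less_day :: "day \<Rightarrow> day \<Rightarrow> bool" where
  "r < s \<longleftrightarrow> day_rank r < day_rank s"

instance
proof
  fix r s t :: day
  show "r < s \<longleftrightarrow> r \<le> s \<and> \<not> s \<le> r"
    by (auto simp: less_eq_day_def less_day_def)
  show "r \<le> r"
    by (simp add: less_eq_day_def)
  show "r \<le> s \<Longrightarrow> s \<le> t \<Longrightarrow> r \<le> t"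
    by (simp add: less_eq_day_def)
  show "r \<le> s \<Longrightarrow> s \<le> r \<Longrightarrow> r = s"
    by (cases r; cases s) (simp_all add: less_eq_day_def)
  show "r \<le> s \<or> s \<le> r"
    by (auto simp: less_eq_day_def)
qed

end

lemma UNIV_day: "UNIV = {Mo, Tu, We, Th, Fr, none}"
  by (auto intro: day.exhaust)

instance day :: finite
  by standard (simp add: UNIV_day)

definition weekdays :: "day set" where
  "weekdays = {Mo, Tu, We, Th, Fr}"

datatype fm = Y day | Bot | Imp fm fm

definition Neg :: "fm \<Rightarrow> fm" where
  "Neg p = Imp p Bot"

definition Top :: fm where
  "Top = Neg Bot"

definition Or :: "fm \<Rightarrow> fm \<Rightarrow> fm" where
  "Or p q = Imp (Neg p) q"

definition And :: "fm \<Rightarrow> fm \<Rightarrow> fm" where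
  "And p q = Neg (Imp p (Neg q))"

definition BigOr :: "fm list \<Rightarrow> fm" where
  "BigOr ps = foldr Or ps Bot"

definition BigAnd :: "fm list \<Rightarrow> fm" where
  "BigAnd ps = foldr And ps Top"

inductive proves :: "fm set \<Rightarrow> fm \<Rightarrow> bool" (infix "\<turnstile>" 50) for A :: "fm set" where
  hyp: "p \<in> A \<Longrightarrow> A \<turnstile> p"
| weaken: "A \<turnstile> Imp p (Imp q p)"
| distrib: "A \<turnstile> Imp (Imp p (Imp q r)) (Imp (Imp p q) (Imp p r))"
| dneg: "A \<turnstile> Imp (Imp (Imp p Bot) Bot) p"
| mp: "A \<turnstile> Imp p q \<Longrightarrow> A \<turnstile> p \<Longrightarrow> A \<turnstile> q"

definition all_days :: "day list" where
  "all_days = sorted_list_of_set (UNIV :: day set)"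

definition Ax_eq1 :: fm where
  "Ax_eq1 = And (BigOr (map Y all_days))
     (BigAnd [Or (Neg (Y r)) (Neg (Y s)). r \<leftarrow> all_days, s \<leftarrow> all_days, r < s])"

definition axiom_system :: "fm set \<Rightarrow> bool" where
  "axiom_system A \<longleftrightarrow> Ax_eq1 \<in> A"

definition inconsistent :: "fm set \<Rightarrow> bool" where
  "inconsistent A \<longleftrightarrow> (\<forall>p. A \<turnstile> p)"

definition consistent :: "fm set \<Rightarrow> bool" where
  "consistent A \<longleftrightarrow> \<not> inconsistent A"

definition equivalent :: "fm set \<Rightarrow> fm set \<Rightarrow> bool" (infix "\<sim>" 50) where
  "A1 \<sim> A2 \<longleftrightarrow> (\<forall>p\<in>A2. A1 \<turnstile> p) \<and> (\<forall>p\<in>A1. A2 \<turnstile> p)"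

definition T_in :: "day set \<Rightarrow> fm" where
  "T_in B = BigOr (map Y (sorted_list_of_set B))"

definition T_le :: "day \<Rightarrow> fm" where
  "T_le d = T_in {r. r \<le> d}"

definition A_of :: "day set \<Rightarrow> fm set" where
  "A_of L = {Ax_eq1, T_in L}"

definition p_knowledge_set :: "fm set \<Rightarrow> day set \<Rightarrow> bool" where
  "p_knowledge_set A K \<longleftrightarrow> A \<turnstile> T_in K"

definition K_of :: "fm set \<Rightarrow> day set" where
  "K_of A = \<Inter> {K. p_knowledge_set A K}"

definition p_surprising :: "fm set \<Rightarrow> day \<Rightarrow> bool" where
  "p_surprising A d \<longleftrightarrow> d \<in> weekdays \<and> d \<in> K_of A \<and> \<not> A \<turnstile> T_le d"

definition D_surpr :: "fm set \<Rightarrow> day set" where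
  "D_surpr A = {d. p_surprising A d}"

definition Iverson :: "bool \<Rightarrow> fm" where
  "Iverson S = (if S then Top else Bot)"

text \<open>The list \<open>map set (subseqs all_days)\<close> enumerates all subsets of \<open>UNIV :: day set\<close>, each
  exactly once. Since \<open>{} - {x} = {}\<close> for every \<open>x\<close>, the unspecified value \<open>Max {}\<close> is harmless.\<close>

definition tau :: "fm set \<Rightarrow> fm" where
  "tau A = BigOr (map
     (\<lambda>d. BigAnd (map
        (\<lambda>K. Imp (Iverson (A \<turnstile> T_in K)) (Iverson (d \<in> K - {Max K})))
        (map set (subseqs all_days))))
     (sorted_list_of_set weekdays))"

end

theory Submission
  imports Defs
begin

text \<open>The formula \<open>tau A\<close> contains no atoms, so it is either provable or refutable outright. If it
  is refutable, then \<open>A\<close> proves both it and its negation and is inconsistent. If it is provable,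
  then \<open>A\<close> is equivalent to \<open>A_of L\<close>, whose p-knowledge sets are exactly the supersets of \<open>L\<close>;
  hence the surprising days are the weekdays in \<open>L\<close> other than its maximum, and the disjunct
  witnessing \<open>tau A\<close>, tested at \<open>K = L\<close>, is one of them.\<close>

section \<open>Derived rules of the Hilbert calculus\<close>

lemma proves_cut:
  assumes "A \<turnstile> p" and "\<And>q. q \<in> A \<Longrightarrow> B \<turnstile> q"
  shows "B \<turnstile> p"
  using assms(1)
proof induction
  case (mp p q)
  then show ?case by (blast intro: proves.mp[of B p q])
qed (blast intro: assms(2) proves.weaken proves.distrib proves.dneg)+

lemma proves_mono: "A \<turnstile> p \<Longrightarrow> A \<subseteq> B \<Longrightarrow> B \<turnstile> p"
  by (erule proves_cut) (auto intro: proves.hyp)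

text \<open>The combinator identity \<open>S K K\<close>, with \<open>distrib\<close> as S and
  \<open>weaken\<close> as K.\<close>

lemma proves_Imp_refl: "A \<turnstile> Imp p p"
  using proves.mp[OF proves.mp[OF proves.distrib[of A p "Imp p p" p] proves.weaken] proves.weaken] .

text \<open>Induction on the derivation: \<open>distrib\<close> carries the discharged hypothesis
  through modus ponens, and \<open>weaken\<close> puts it in front of axioms and of the remaining
  hypotheses.\<close>

lemma deduction:
  assumes "insert p A \<turnstile> q"
  shows "A \<turnstile> Imp p q"
  using assms
proof induction
  case (hyp q)
  then show ?case
    by (auto intro: proves_Imp_refl proves.mp[OF proves.weaken proves.hyp])
next
  case (mp q r)
  then show ?case by (blast intro: proves.mp[OF proves.mp[OF proves.distrib]])
qed (rule proves.mp[OF proves.weaken], rule proves.weaken proves.distrib proves.dneg)+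

lemma proves_Imp_iff: "A \<turnstile> Imp p q \<longleftrightarrow> insert p A \<turnstile> q"
proof
  assume "A \<turnstile> Imp p q"
  then have "insert p A \<turnstile> Imp p q" by (rule proves_mono) auto
  then show "insert p A \<turnstile> q" by (rule proves.mp) (simp add: proves.hyp)
qed (rule deduction)

lemma proves_classical:
  assumes "insert (Neg p) A \<turnstile> Bot"
  shows "A \<turnstile> p"
  using proves.mp[OF proves.dneg deduction[OF assms[unfolded Neg_def]]] .

lemma proves_Bot_elim: "A \<turnstile> Bot \<Longrightarrow> A \<turnstile> p"
  by (rule proves_classical, erule proves_mono) blast

lemma proves_Neg_elim: "A \<turnstile> Neg p \<Longrightarrow> A \<turnstile> p \<Longrightarrow> A \<turnstile> q"
  unfolding Neg_def by (rule proves_Bot_elim) (rule proves.mp)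

lemma proves_Top: "A \<turnstile> Top"
  by (simp add: Top_def Neg_def proves_Imp_refl)

lemma proves_Or_left:
  assumes "A \<turnstile> p"
  shows "A \<turnstile> Or p q"
proof -
  have "insert (Neg p) A \<turnstile> Neg p" by (simp add: proves.hyp)
  moreover have "insert (Neg p) A \<turnstile> p" using assms by (rule proves_mono) blast
  ultimately have "insert (Neg p) A \<turnstile> q" by (rule proves_Neg_elim)
  then show ?thesis unfolding Or_def by (rule deduction)
qed

lemma proves_Or_right: "A \<turnstile> q \<Longrightarrow> A \<turnstile> Or p q"
  unfolding Or_def by (rule proves.mp[OF proves.weaken])

text \<open>As \<open>Or p q\<close> abbreviates \<open>Imp (Neg p) q\<close>, case analysis has to
  be classical: under \<open>Neg r\<close> the formula \<open>p\<close> is refuted, which releases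
  \<open>q\<close> and hence \<open>r\<close>, a contradiction.\<close>

lemma proves_Or_elim:
  assumes "A \<turnstile> Or p q" and "A \<turnstile> Imp p r" and "A \<turnstile> Imp q r"
  shows "A \<turnstile> r"
proof (rule proves_classical)
  let ?B = "insert (Neg r) A"
  have mono: "?B \<turnstile> s" if "A \<turnstile> s" for s
    using that by (rule proves_mono) auto
  have neg_r: "?B \<turnstile> Neg r" by (simp add: proves.hyp)
  have "insert p ?B \<turnstile> r"
    using mono[OF assms(2)] by (simp add: proves_Imp_iff)
  moreover have "insert p ?B \<turnstile> Neg r" by (simp add: proves.hyp)
  ultimately have "?B \<turnstile> Neg p"
    unfolding Neg_def[of p] by (metis deduction proves_Neg_elim)
  then have "?B \<turnstile> q"
    using mono[OF assms(1)] unfolding Or_def by (metis proves.mp)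
  then have "?B \<turnstile> r"
    using mono[OF assms(3)] by (metis proves.mp)
  with neg_r show "?B \<turnstile> Bot" by (rule proves_Neg_elim)
qed

lemma proves_And_intro:
  assumes "A \<turnstile> p" and "A \<turnstile> q"
  shows "A \<turnstile> And p q"
proof -
  let ?B = "insert (Imp p (Neg q)) A"
  have mono: "?B \<turnstile> s" if "A \<turnstile> s" for s
    using that by (rule proves_mono) auto
  have "?B \<turnstile> Neg q"
    by (rule proves.mp[OF _ mono[OF assms(1)]]) (simp add: proves.hyp)
  then have "?B \<turnstile> Bot" using mono[OF assms(2)] by (rule proves_Neg_elim)
  then show ?thesis unfolding And_def Neg_def[of "Imp p (Neg q)"] by (rule deduction)
qed

text \<open>\<open>And p q\<close> denies \<open>Imp p (Neg q)\<close>, and that implication holds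
  vacuously once \<open>p\<close> is refuted.\<close>

lemma proves_And_left:
  assumes "A \<turnstile> And p q"
  shows "A \<turnstile> p"
proof (rule proves_classical)
  let ?B = "insert (Neg p) A"
  have "insert p ?B \<turnstile> Neg q"
    by (rule proves_Neg_elim[of _ p]) (simp_all add: proves.hyp)
  then have "?B \<turnstile> Imp p (Neg q)" by (rule deduction)
  moreover have "?B \<turnstile> Neg (Imp p (Neg q))"
    using assms unfolding And_def by (rule proves_mono) auto
  ultimately show "?B \<turnstile> Bot" by (metis proves_Neg_elim)
qed

lemma proves_And_right:
  assumes "A \<turnstile> And p q"
  shows "A \<turnstile> q"
proof (rule proves_classical)
  let ?B = "insert (Neg q) A"
  have "?B \<turnstile> Imp p (Neg q)" by (rule deduction) (simp add: proves.hyp)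
  moreover have "?B \<turnstile> Neg (Imp p (Neg q))"
    using assms unfolding And_def by (rule proves_mono) auto
  ultimately show "?B \<turnstile> Bot" by (metis proves_Neg_elim)
qed

lemma proves_BigOr_intro: "p \<in> set ps \<Longrightarrow> A \<turnstile> p \<Longrightarrow> A \<turnstile> BigOr ps"
  unfolding BigOr_def by (induction ps) (auto intro: proves_Or_left proves_Or_right)

lemma proves_BigOr_elim:
  assumes "A \<turnstile> BigOr ps" and "\<And>p. p \<in> set ps \<Longrightarrow> A \<turnstile> Imp p q"
  shows "A \<turnstile> q"
proof -
  \<comment> \<open>The induction runs on an object-level implication, because a provable
    disjunction need not have a provable disjunct or tail.\<close>
  have "A \<turnstile> Imp (BigOr ps) q"
    using assms(2)
  proof (induction ps)
    case Nil
    show ?case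
      by (rule deduction, rule proves_Bot_elim) (simp add: BigOr_def proves.hyp)
  next
    case (Cons p ps)
    let ?B = "insert (BigOr (p # ps)) A"
    have "?B \<turnstile> Or p (BigOr ps)" by (simp add: BigOr_def proves.hyp)
    moreover have "?B \<turnstile> Imp p q" "?B \<turnstile> Imp (BigOr ps) q"
      using Cons by (auto intro: proves_mono[of A])
    ultimately show ?case by (intro deduction) (rule proves_Or_elim)
  qed
  then show ?thesis using assms(1) by (rule proves.mp)
qed

lemma proves_BigAnd_iff: "A \<turnstile> BigAnd ps \<longleftrightarrow> (\<forall>p\<in>set ps. A \<turnstile> p)"
  unfolding BigAnd_def
  by (induction ps) (auto intro: proves_Top proves_And_intro dest: proves_And_left proves_And_right)

section \<open>Soundness for the six models, one for each day\<close>

primrec holds :: "day \<Rightarrow> fm \<Rightarrow> bool" where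
  "holds r (Y s) \<longleftrightarrow> s = r"
| "holds r Bot \<longleftrightarrow> False"
| "holds r (Imp p q) \<longleftrightarrow> (holds r p \<longrightarrow> holds r q)"

lemma soundness:
  assumes "A \<turnstile> p" and "\<And>q. q \<in> A \<Longrightarrow> holds r q"
  shows "holds r p"
  using assms(1) by induction (auto intro: assms(2))

lemma holds_BigOr: "holds r (BigOr ps) \<longleftrightarrow> (\<exists>p\<in>set ps. holds r p)"
  by (induction ps) (auto simp: BigOr_def Or_def Neg_def)

lemma holds_BigAnd: "holds r (BigAnd ps) \<longleftrightarrow> (\<forall>p\<in>set ps. holds r p)"
  by (induction ps) (auto simp: BigAnd_def And_def Top_def Neg_def)

lemma set_all_days: "set all_days = UNIV"
  by (simp add: all_days_def)

lemma holds_Ax_eq1: "holds r Ax_eq1"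
  by (auto simp: Ax_eq1_def And_def Or_def Neg_def holds_BigOr holds_BigAnd set_all_days)

lemma holds_T_in: "holds r (T_in K) \<longleftrightarrow> r \<in> K"
  by (auto simp: T_in_def holds_BigOr)

lemma proves_T_in_mono:
  assumes "A \<turnstile> T_in L" and "L \<subseteq> K"
  shows "A \<turnstile> T_in K"
  using assms(1) unfolding T_in_def[of L]
proof (rule proves_BigOr_elim)
  fix p assume "p \<in> set (map Y (sorted_list_of_set L))"
  then have "p \<in> set (map Y (sorted_list_of_set K))" using assms(2) by auto
  then show "A \<turnstile> Imp p (T_in K)"
    unfolding T_in_def by (intro deduction) (rule proves_BigOr_intro[of p], simp_all add: proves.hyp)
qed

text \<open>Every element of \<open>L\<close> is a model of \<open>A_of L\<close>, so soundness
  forces it into \<open>K\<close>; conversely, the axiom \<open>T_in L\<close> only has to be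
  weakened. For empty \<open>L\<close> the axiom is \<open>Bot\<close> and everything is
  provable.\<close>

lemma A_of_proves_T_in_iff: "A_of L \<turnstile> T_in K \<longleftrightarrow> L \<subseteq> K"
proof
  assume proves: "A_of L \<turnstile> T_in K"
  have "holds r (T_in K)" if "r \<in> L" for r
    using proves by (rule soundness) (use that in \<open>auto simp: A_of_def holds_Ax_eq1 holds_T_in\<close>)
  then show "L \<subseteq> K" by (auto simp: holds_T_in)
next
  assume "L \<subseteq> K"
  moreover have "A_of L \<turnstile> T_in L" by (simp add: A_of_def proves.hyp)
  ultimately show "A_of L \<turnstile> T_in K" by (blast intro: proves_T_in_mono)
qed

section \<open>The closed formula \<open>tau A\<close>, decided by its metalevel truth value\<close>

definition tau_true :: "fm set \<Rightarrow> bool" where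
  "tau_true A \<longleftrightarrow> (\<exists>d\<in>weekdays. \<forall>K. A \<turnstile> T_in K \<longrightarrow> d \<in> K - {Max K})"

lemma set_map_set_subseqs_all_days: "set (map set (subseqs all_days)) = UNIV"
  using subseqs_powset[of all_days] by (simp add: set_all_days)

text \<open>For the witnessing day, each conjunct is an implication between constants with premise
  \<open>Bot\<close> or conclusion \<open>Top\<close>. It is therefore provable in an arbitrary
  \<open>B\<close>, which need not be related to \<open>A\<close>.\<close>

lemma proves_tau:
  assumes "tau_true A"
  shows "B \<turnstile> tau A"
proof -
  obtain d where d: "d \<in> weekdays" "\<And>K. A \<turnstile> T_in K \<Longrightarrow> d \<in> K - {Max K}"
    using assms unfolding tau_true_def by blast
  have "B \<turnstile> Imp (Iverson (A \<turnstile> T_in K)) (Iverson (d \<in> K - {Max K}))" for K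
  proof (cases "A \<turnstile> T_in K")
    case True
    then show ?thesis
      using d(2) by (intro deduction) (simp add: Iverson_def proves_Top)
  next
    case False
    have "insert Bot B \<turnstile> Bot" by (simp add: proves.hyp)
    then show ?thesis
      using False by (simp add: Iverson_def deduction proves_Bot_elim)
  qed
  then have "B \<turnstile> BigAnd (map (\<lambda>K. Imp (Iverson (A \<turnstile> T_in K)) (Iverson (d \<in> K - {Max K})))
      (map set (subseqs all_days)))"
    by (auto simp: proves_BigAnd_iff)
  moreover have "d \<in> set (sorted_list_of_set weekdays)" using d(1) by simp
  ultimately show ?thesis
    unfolding tau_def by (intro proves_BigOr_intro[rotated]) (assumption, simp)
qed

text \<open>If no day is a witness, every disjunct of \<open>tau A\<close> contains a false conjunct
  and is refutable.\<close>

lemma proves_tau_inconsistent: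
  assumes "B \<turnstile> tau A" and "\<not> tau_true A"
  shows "inconsistent B"
proof -
  have "B \<turnstile> Bot"
    using assms(1) unfolding tau_def
  proof (rule proves_BigOr_elim)
    let ?conj = "\<lambda>d. BigAnd (map (\<lambda>K. Imp (Iverson (A \<turnstile> T_in K)) (Iverson (d \<in> K - {Max K})))
      (map set (subseqs all_days)))"
    fix p assume "p \<in> set (map ?conj (sorted_list_of_set weekdays))"
    then obtain d where d: "d \<in> weekdays" and p: "p = ?conj d" by auto
    obtain K where K: "A \<turnstile> T_in K" "d \<notin> K - {Max K}"
      using assms(2) d unfolding tau_true_def by blast
    have "K \<in> set (map set (subseqs all_days))"
      unfolding set_map_set_subseqs_all_days by simp
    moreover have "insert p B \<turnstile> ?conj d" by (simp add: p proves.hyp)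
    ultimately have "insert p B \<turnstile> Imp (Iverson (A \<turnstile> T_in K)) (Iverson (d \<in> K - {Max K}))"
      unfolding proves_BigAnd_iff set_map[of _ "map set (subseqs all_days)"] by blast
    \<comment> \<open>The choice of \<open>K\<close> makes the premise bracket \<open>Top\<close>
      and the conclusion bracket \<open>Bot\<close>.\<close>
    then have "insert p B \<turnstile> Imp Top Bot"
      using K by (simp add: Iverson_def split: if_splits)
    then have "insert p B \<turnstile> Bot" using proves_Top by (rule proves.mp)
    then show "B \<turnstile> Imp p Bot" by (rule deduction)
  qed
  then show ?thesis unfolding inconsistent_def by (blast intro: proves_Bot_elim)
qed

section \<open>Surprising days and solutions of the fixpoint equation\<close>

lemma equivalent_proves_iff:
  assumes "A \<sim> B"
  shows "A \<turnstile> p \<longleftrightarrow> B \<turnstile> p"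
  using assms unfolding equivalent_def by (meson proves_cut)

text \<open>Such a system proves every \<open>T_le d\<close>, which surprise forbids.\<close>

lemma D_surpr_inconsistent: "inconsistent A \<Longrightarrow> D_surpr A = {}"
  by (auto simp: D_surpr_def p_surprising_def inconsistent_def)

lemma D_surpr_equivalent_A_of:
  assumes "A \<sim> A_of L"
  shows "D_surpr A = weekdays \<inter> L - {Max L}"
proof -
  have know: "A \<turnstile> T_in K \<longleftrightarrow> L \<subseteq> K" for K
    using equivalent_proves_iff[OF assms] by (simp add: A_of_proves_T_in_iff)
  \<comment> \<open>\<open>L\<close> is itself a p-knowledge set and is contained in all
    others.\<close>
  have "K_of A = L" by (auto simp: K_of_def p_knowledge_set_def know)
  \<comment> \<open>The left side expresses that \<open>A\<close> proves \<open>T_le d\<close>, so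
    the only day of \<open>L\<close> lost to this condition is the maximum.\<close>
  moreover have "L \<subseteq> {r. r \<le> d} \<longleftrightarrow> d = Max L" if "d \<in> L" for d
    using that Max_eq_iff[of L d] by auto
  ultimately show ?thesis
    by (auto simp: D_surpr_def p_surprising_def T_le_def know)
qed

text \<open>One case distinction serves both claims: consistency excludes the first alternative, and
  a lack of weekdays in \<open>L\<close> besides its maximum excludes the second.\<close>

lemma tau_fixpoint_cases:
  assumes "A \<sim> A_of L \<union> {tau A}"
  obtains (inconsistent) "inconsistent A"
    | (A_of) "A \<sim> A_of L" "weekdays \<inter> L - {Max L} \<noteq> {}"
proof (cases "tau_true A")
  case True
  \<comment> \<open>With \<open>tau A\<close> provable in every system, it can be cut from the
    axioms.\<close>
  have "A_of L \<turnstile> q" if "q \<in> A" for q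
  proof (rule proves_cut)
    show "A_of L \<union> {tau A} \<turnstile> q" using assms that by (simp add: equivalent_def)
  qed (auto intro: proves.hyp proves_tau[OF True])
  then have equiv: "A \<sim> A_of L" using assms by (simp add: equivalent_def)
  then have "A \<turnstile> T_in L"
    by (simp add: equivalent_proves_iff A_of_proves_T_in_iff)
  \<comment> \<open>Instantiating \<open>tau_true A\<close> at \<open>K = L\<close> places the
    witness in this set.\<close>
  then have "weekdays \<inter> L - {Max L} \<noteq> {}"
    using True unfolding tau_true_def by blast
  with equiv show thesis by (rule A_of)
next
  case False
  have "A \<turnstile> tau A" using assms by (simp add: equivalent_def)
  then show thesis using False by (intro inconsistent) (rule proves_tau_inconsistent)
qed

theorem theorem5p4:
  fixes L :: "day set"
  shows "(weekdays \<inter> L - {Max L} \<noteq> {} \<longrightarrow>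
            (\<forall>A. axiom_system A \<and> A \<sim> A_of L \<union> {tau A} \<and> consistent A \<longrightarrow>
                 A \<sim> A_of L \<and> D_surpr A = weekdays \<inter> L - {Max L})) \<and>
         (weekdays \<inter> L \<subseteq> {Max L} \<longrightarrow>
            (\<forall>A. axiom_system A \<and> A \<sim> A_of L \<union> {tau A} \<longrightarrow>
                 inconsistent A \<and> D_surpr A = {}))"
proof (intro conjI[of "_ \<longrightarrow> _"] impI allI)
  fix A
  assume "axiom_system A \<and> A \<sim> A_of L \<union> {tau A} \<and> consistent A"
  then have "A \<sim> A_of L"
    unfolding consistent_def by (blast elim: tau_fixpoint_cases)
  then show "A \<sim> A_of L \<and> D_surpr A = weekdays \<inter> L - {Max L}"
    by (simp add: D_surpr_equivalent_A_of)
next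
  fix A
  assume "weekdays \<inter> L \<subseteq> {Max L}" and "axiom_system A \<and> A \<sim> A_of L \<union> {tau A}"
  \<comment> \<open>The inclusion leaves \<open>weekdays \<inter> L - {Max L}\<close> empty, so only
    the inconsistent alternative remains.\<close>
  then have "inconsistent A" by (blast elim: tau_fixpoint_cases)
  then show "inconsistent A \<and> D_surpr A = {}" by (simp add: D_surpr_inconsistent)
qed

end
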